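(* Let $C$ be a strictly compact MWS code of dimension $k$ over $\mathbb{F}_q$, and write $q_k=\frac{q^k-1}{q-1}$. Then the parameters $[n,k,d]_q$ of $C$ are $$\left[\;\frac{q}{2}\,q_k\;,\;k\;,\;\left(\frac{q}{2}-1\right)q_k+1\;\right]_q ,$$ that is, its length is $n=\frac{q}{2}q_k$ and its minimum distance is $d=\left(\frac{q}{2}-1\right)q_k+1$.
   Context: $\mathbb{F}_q$ is the finite field with $q$ elements. An $[n,k]_q$ linear code is a $k$-dimensional subspace of $\mathbb{F}_q^n$; it is an $[n,k,d]_q$ code if its minimum distance (smallest nonzero Hamming weight of a codeword) is $d$. For a linear code $C$, $S(C)$ denotes the set of Hamming weights of nonzero codewords of $C$. A $k$-dimensional linear code over $\mathbb{F}_q$ has at most $q_k=\frac{q^k-1}{q-1}$ distinct nonzero weights; it is called a maximum weight spectrum (MWS) code if $|S(C)|=q_k$. An $[n,k,d]_q$ MWS code $C$ is compact if $S(C)=\{d,d+1,\ldots,d+q_k-1\}$, and strictly compact if it is compact and $n\in S(C)$.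
   Formalization: The formal theorem assumes dimension k ≥ 2; for k = 1 the claim fails, e.g. the binary code {00, 11} is strictly compact MWS with n = d = 2, while the formula gives n = d = 1. *)

theory Defs
  imports "HOL-Analysis.Analysis"
begin

text \<open>
  The field with \<open>q\<close> elements is a type \<open>'a\<close> of classes \<open>field\<close> and \<open>finite\<close>, with
  \<open>q = CARD('a)\<close>; the ambient space is \<open>'a ^ 'n\<close>, so a code has length \<open>CARD('n)\<close>.
\<close>

definition linear_code :: "nat \<Rightarrow> ('a::{field,finite} ^ 'n) set \<Rightarrow> bool" where
  "linear_code k C \<longleftrightarrow> vec.subspace C \<and> vec.dim C = k"

definition hamming_weight :: "'a::zero ^ 'n \<Rightarrow> nat" where
  "hamming_weight v = card {i. v $ i \<noteq> 0}"

definition weight_set :: "('a::zero ^ 'n) set \<Rightarrow> nat set" where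
  "weight_set C = hamming_weight ` (C - {0})"

text \<open>Unspecified for the zero code, which has no nonzero weights.\<close>

definition min_distance :: "('a::zero ^ 'n) set \<Rightarrow> nat" where
  "min_distance C = Min (weight_set C)"

text \<open>The number \<open>q\<^sub>k\<close>; the division is exact for \<open>q \<ge> 2\<close>.\<close>

definition max_weights :: "nat \<Rightarrow> nat \<Rightarrow> nat" where
  "max_weights q k = (q ^ k - 1) div (q - 1)"

definition MWS_code :: "nat \<Rightarrow> ('a::{field,finite} ^ 'n) set \<Rightarrow> bool" where
  "MWS_code k C \<longleftrightarrow> linear_code k C \<and> card (weight_set C) = max_weights CARD('a) k"

definition compact_MWS_code :: "nat \<Rightarrow> ('a::{field,finite} ^ 'n) set \<Rightarrow> bool" where
  "compact_MWS_code k C \<longleftrightarrow> MWS_code k C \<and>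
     weight_set C = {min_distance C ..< min_distance C + max_weights CARD('a) k}"

definition strictly_compact_MWS_code :: "nat \<Rightarrow> ('a::{field,finite} ^ 'n) set \<Rightarrow> bool" where
  "strictly_compact_MWS_code k C \<longleftrightarrow> compact_MWS_code k C \<and> CARD('n) \<in> weight_set C"

end

theory Submission
  imports Defs
begin

text \<open>
  The proof counts the total weight \<open>W\<close> of all codewords in two ways. Let \<open>Q\<close> denote
  \<open>q\<^sub>k = max_weights q k\<close>.

  \<^item> By weights: nonzero scalar multiples of a word have its weight, so each of the \<open>Q\<close>
    weights is attained by at least \<open>q - 1\<close> words. There are only \<open>(q - 1) * Q\<close> nonzero words,
    so each weight is attained by exactly \<open>q - 1\<close> of them (\<open>MWS_code_card_weight_class\<close>).
    As the weights are \<open>d, \<dots>, d + Q - 1\<close>, this gives \<open>W = (q - 1) * (Q * d + Q * (Q - 1) / 2)\<close>.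

  \<^item> By coordinates: a word of weight \<open>n\<close> shows that no coordinate vanishes identically on
    the code, so each coordinate is nonzero on a fraction \<open>(q - 1) / q\<close> of the \<open>q ^ k\<close> words
    (\<open>card_nonzero_coordinate\<close>). Hence \<open>W = n * (q - 1) * q ^ (k - 1)\<close>.

  The largest weight \<open>d + Q - 1\<close> must be \<open>n\<close>. Eliminating \<open>d\<close> leaves
  \<open>2 * n * (Q - q ^ (k - 1)) = Q * (Q - 1)\<close>, and since \<open>q * (Q - q ^ (k - 1)) = Q - 1\<close>, which
  is nonzero for \<open>k \<ge> 2\<close>, this determines \<open>n = q * Q / 2\<close>, and with it \<open>d\<close>.
\<close>

section \<open>Subspaces over a finite field\<close>

lemma two_le_card_field: "2 \<le> CARD('a::{field,finite})"
proof -
  have "card {0, 1 :: 'a} \<le> CARD('a)"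
    by (rule card_mono) auto
  then show ?thesis by simp
qed

text \<open>Coordinates with respect to a basis identify the subspace with the functions from the
  basis to the field.\<close>

lemma card_subspace:
  fixes C :: "('a::{field,finite} ^ 'n) set"
  assumes "vec.subspace C"
  shows "card C = CARD('a) ^ vec.dim C"
proof -
  obtain B where B: "B \<subseteq> C" "vec.independent B" "C \<subseteq> vec.span B" "card B = vec.dim C"
    using vec.basis_exists[of C] by metis
  define f where "f = (\<lambda>u::'a^'n \<Rightarrow> 'a. \<Sum>v\<in>B. u v *s v)"
  have C: "C = vec.span B"
    using B assms by (meson subset_antisym vec.span_minimal)
  have "inj_on f (B \<rightarrow>\<^sub>E UNIV)"
  proof (rule inj_onI)
    fix u u' assume u: "u \<in> B \<rightarrow>\<^sub>E UNIV" "u' \<in> B \<rightarrow>\<^sub>E UNIV" and eq: "f u = f u'"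
    have "(\<Sum>v\<in>B. (u v - u' v) *s v) = 0"
      using eq by (simp add: f_def vec.scale_left_diff_distrib sum_subtractf)
    then have "u v - u' v = 0" if "v \<in> B" for v
      using vec.independentD[OF B(2), of B "\<lambda>v. u v - u' v" v] that by simp
    then show "u = u'"
      using u by (intro PiE_ext) auto
  qed
  moreover have "f ` (B \<rightarrow>\<^sub>E UNIV) = C"
  proof -
    have "f u \<in> f ` (B \<rightarrow>\<^sub>E UNIV)" for u
    proof
      show "f u = f (restrict u B)" by (simp add: f_def)
    qed auto
    then have "f ` (B \<rightarrow>\<^sub>E UNIV) = range f" by blast
    then show ?thesis
      by (simp add: C vec.span_finite f_def)
  qed
  ultimately have "card C = card (B \<rightarrow>\<^sub>E (UNIV :: 'a set))"
    using card_image by metis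
  then show ?thesis
    by (simp add: card_funcsetE B(4))
qed

text \<open>A coordinate that does not vanish identically is a nonzero linear form. Translation by a
  multiple of a word where it is \<open>1\<close> shows that all its fibres have the same size.\<close>

lemma card_nonzero_coordinate:
  fixes C :: "('a::{field,finite} ^ 'n) set"
  assumes C: "vec.subspace C" and x: "x \<in> C" "x $ i \<noteq> 0"
  shows "CARD('a) * card {v \<in> C. v $ i \<noteq> 0} = (CARD('a) - 1) * card C"
proof -
  define y where "y = inverse (x $ i) *s x"
  have y: "y \<in> C" "y $ i = 1"
    using x vec.subspace_scale[OF C] by (auto simp: y_def)
  let ?K = "{v \<in> C. v $ i = 0}"
  have fibre: "card {v \<in> C. v $ i = c} = card ?K" for c
    using y vec.subspace_add[OF C] vec.subspace_diff[OF C] vec.subspace_scale[OF C]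
    by (intro bij_betw_same_card[OF bij_betw_byWitness
          [where f = "\<lambda>v. v - c *s y" and f' = "\<lambda>v. v + c *s y"]]) auto
  have "card C = (\<Sum>c\<in>(UNIV :: 'a set). card {v \<in> C. v $ i = c})"
    using sum.group[of C UNIV "\<lambda>v. v $ i" "\<lambda>_. 1::nat"] by simp
  also have "\<dots> = (\<Sum>c\<in>(UNIV :: 'a set). card ?K)"
    by (intro sum.cong refl fibre)
  finally have total: "card C = CARD('a) * card ?K"
    by simp
  have "C = ?K \<union> {v \<in> C. v $ i \<noteq> 0}" by auto
  then have "card C = card ?K + card {v \<in> C. v $ i \<noteq> 0}"
    by (metis (no_types, lifting) card_Un_disjoint disjoint_iff finite mem_Collect_eq)
  then have "CARD('a) * card C = CARD('a) * card ?K + CARD('a) * card {v \<in> C. v $ i \<noteq> 0}"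
    by (simp only: distrib_left)
  then have "CARD('a) * card C = card C + CARD('a) * card {v \<in> C. v $ i \<noteq> 0}"
    by (simp only: total[symmetric])
  then show ?thesis
    by (simp add: diff_mult_distrib)
qed

section \<open>Weights of codewords\<close>

lemma hamming_weight_scale:
  fixes v :: "'a::field ^ 'n"
  shows "c \<noteq> 0 \<Longrightarrow> hamming_weight (c *s v) = hamming_weight v"
  by (simp add: hamming_weight_def)

lemma hamming_weight_le_length: "hamming_weight (v :: 'a::zero ^ 'n) \<le> CARD('n)"
  unfolding hamming_weight_def by (rule card_mono) auto

lemma hamming_weight_eq_length:
  fixes v :: "'a::zero ^ 'n"
  assumes "hamming_weight v = CARD('n)"
  shows "v $ i \<noteq> 0"
proof -
  have "{i. v $ i \<noteq> 0} = UNIV"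
    using assms by (intro card_subset_eq) (auto simp: hamming_weight_def)
  then show ?thesis by auto
qed

text \<open>The count by coordinates. The word of full length ensures that every coordinate
  contributes equally.\<close>

lemma sum_hamming_weight_full_length:
  fixes C :: "('a::{field,finite} ^ 'n) set"
  assumes C: "vec.subspace C" and x: "x \<in> C" "hamming_weight x = CARD('n)"
  shows "CARD('a) * (\<Sum>v\<in>C. hamming_weight v) = CARD('n) * ((CARD('a) - 1) * card C)"
proof -
  have "(\<Sum>v\<in>C. hamming_weight v) = (\<Sum>v\<in>C. \<Sum>i\<in>UNIV. if v $ i \<noteq> 0 then 1 else 0)"
    by (simp add: hamming_weight_def sum.If_cases)
  also have "\<dots> = (\<Sum>i\<in>UNIV. \<Sum>v\<in>C. if v $ i \<noteq> 0 then 1 else 0)"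
    by (rule sum.swap)
  also have "\<dots> = (\<Sum>i\<in>UNIV. card {v \<in> C. v $ i \<noteq> 0})"
    by (simp add: sum.If_cases Int_def)
  finally show ?thesis
    using card_nonzero_coordinate[OF C x(1) hamming_weight_eq_length[OF x(2)]]
    by (simp add: sum_distrib_left)
qed

lemma card_weight_class_ge:
  fixes C :: "('a::{field,finite} ^ 'n) set"
  assumes C: "vec.subspace C" and w: "w \<in> weight_set C"
  shows "CARD('a) - 1 \<le> card {v \<in> C - {0}. hamming_weight v = w}"
proof -
  obtain v where v: "v \<in> C" "v \<noteq> 0" "w = hamming_weight v"
    using w by (auto simp: weight_set_def)
  have "inj_on (\<lambda>c. c *s v) (UNIV - {0})"
    using v(2) by (auto intro: inj_onI)
  then have "CARD('a) - 1 = card ((\<lambda>c. c *s v) ` (UNIV - {0}))"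
    by (simp add: card_image)
  also have "\<dots> \<le> card {v \<in> C - {0}. hamming_weight v = w}"
    using v vec.subspace_scale[OF C] by (intro card_mono) (auto simp: hamming_weight_scale)
  finally show ?thesis .
qed

section \<open>Maximum weight spectrum codes\<close>

lemma max_weights_mult:
  assumes "q \<ge> 1"
  shows "(q - 1) * max_weights q k = q ^ k - 1"
proof -
  have "int (q ^ k - 1) = int (q - 1) * (\<Sum>i<k. int q ^ i)"
    using assms power_diff_1_eq[of "int q" k] by (simp add: of_nat_diff)
  then have "int (q ^ k - 1) = int ((q - 1) * (\<Sum>i<k. q ^ i))"
    by simp
  then have "(q - 1) dvd (q ^ k - 1)"
    by (metis dvd_triv_left of_nat_eq_iff)
  then show ?thesis
    by (simp add: max_weights_def)
qed

text \<open>The lower bounds \<open>q - 1\<close> for the sizes of the weight classes add up to the number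
  \<open>q ^ k - 1\<close> of all nonzero words, so all of them are attained.\<close>

lemma MWS_code_card_weight_class:
  fixes C :: "('a::{field,finite} ^ 'n) set"
  assumes mws: "MWS_code k C" and w: "w \<in> weight_set C"
  shows "card {v \<in> C - {0}. hamming_weight v = w} = CARD('a) - 1"
proof -
  have C: "vec.subspace C" and k: "vec.dim C = k"
    and card_S: "card (weight_set C) = max_weights CARD('a) k"
    using mws by (auto simp: MWS_code_def linear_code_def)
  have "(\<Sum>w\<in>weight_set C. card {v \<in> C - {0}. hamming_weight v = w}) = card (C - {0})"
    using sum.group[of "C - {0}" "weight_set C" hamming_weight "\<lambda>_. 1::nat"]
    by (simp add: weight_set_def)
  also have "\<dots> = CARD('a) ^ k - 1"
    using card_subspace[OF C] k vec.subspace_0[OF C] by simp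
  also have "\<dots> = (\<Sum>w\<in>weight_set C. CARD('a) - 1)"
    using max_weights_mult[of "CARD('a)" k] two_le_card_field[where 'a = 'a]
    by (simp add: card_S mult.commute)
  finally show ?thesis
    using sum_mono_inv[of "\<lambda>_. CARD('a) - 1" "weight_set C"
        "\<lambda>w. card {v \<in> C - {0}. hamming_weight v = w}" w]
      card_weight_class_ge[OF C] w
    by (simp add: weight_set_def)
qed

text \<open>The count by weights: every weight \<open>w\<close> contributes \<open>(q - 1) * w\<close> to the total.\<close>

lemma MWS_code_sum_hamming_weight:
  fixes C :: "('a::{field,finite} ^ 'n) set"
  assumes mws: "MWS_code k C"
  shows "(\<Sum>v\<in>C. hamming_weight v) = (CARD('a) - 1) * \<Sum>(weight_set C)"
proof -
  have "(\<Sum>v\<in>C. hamming_weight v) = (\<Sum>v\<in>C - {0}. hamming_weight v)"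
    by (rule sum.mono_neutral_right) (auto simp: hamming_weight_def)
  also have "\<dots> = (\<Sum>w\<in>weight_set C. \<Sum>v | v \<in> C - {0} \<and> hamming_weight v = w. hamming_weight v)"
    by (rule sum.group[symmetric]) (auto simp: weight_set_def)
  also have "\<dots> = (\<Sum>w\<in>weight_set C. (CARD('a) - 1) * w)"
  proof (rule sum.cong)
    fix w assume "w \<in> weight_set C"
    then show "(\<Sum>v | v \<in> C - {0} \<and> hamming_weight v = w. hamming_weight v) = (CARD('a) - 1) * w"
      using MWS_code_card_weight_class[OF mws] by simp
  qed simp
  finally show ?thesis
    by (simp add: sum_distrib_left)
qed

lemma real_sum_consecutive:
  "2 * real (\<Sum>{d..<d + m}) = real m * (2 * real d + real m - 1)"
  by (induction m) (simp_all add: algebra_simps)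

theorem theorem9:
  fixes C :: "('a::{field,finite} ^ 'n) set" and q k :: nat
  assumes "CARD('a) = q"
    and "k \<ge> 2"
    and "strictly_compact_MWS_code k C"
  shows "real CARD('n) = real q / 2 * real (max_weights q k)
       \<and> real (min_distance C) = (real q / 2 - 1) * real (max_weights q k) + 1"
proof -
  define n d Q where "n = CARD('n)" and "d = min_distance C" and "Q = max_weights q k"
  have q: "q \<ge> 2"
    using two_le_card_field[where 'a = 'a] assms(1) by simp
  have mws: "MWS_code k C" and S: "weight_set C = {d..<d + Q}" and n_weight: "n \<in> weight_set C"
    using assms(1,3)
    by (auto simp: strictly_compact_MWS_code_def compact_MWS_code_def n_def d_def Q_def)
  have C: "vec.subspace C" and card_C: "card C = q ^ k"
    using mws card_subspace assms(1) by (auto simp: MWS_code_def linear_code_def)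
  obtain x where x: "x \<in> C" "hamming_weight x = CARD('n)"
    using n_weight unfolding weight_set_def n_def by (metis DiffD1 imageE)

  have "d + Q - 1 \<in> weight_set C"
    using S n_weight by auto
  then have "d + Q - 1 \<le> n"
    unfolding weight_set_def n_def by (metis imageE hamming_weight_le_length)
  then have "n + 1 = d + Q"
    using S n_weight by auto
  then have n: "real n = real d + real Q - 1"
    by linarith

  define q' where "q' = real q - 1"
  have q': "q' > 0" "real (q - 1) = q'"
    using q by (auto simp: q'_def)
  have "(q - 1) * Q = q ^ k - 1"
    using max_weights_mult q by (simp add: Q_def)
  then have "(q - 1) * Q + 1 = q ^ k"
    using q by simp
  then have Q: "real (q ^ k) = q' * real Q + 1"
    using q'(2) by (metis of_nat_1 of_nat_add of_nat_mult)
  have "real q = q' + 1"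
    by (simp add: q'_def)
  have "q < q ^ k"
    using q assms(2) power_strict_increasing[of 1 k q] by simp
  then have "real q < real (q ^ k)"
    by (simp only: of_nat_less_iff)
  then have "q' * 1 < q' * real Q"
    using Q \<open>real q = q' + 1\<close> by simp
  then have Q1: "real Q - 1 \<noteq> 0"
    using q'(1) by auto

  \<comment> \<open>Equate the two counts, multiplied by \<open>q\<close> to turn \<open>q ^ (k - 1)\<close> into \<open>q ^ k\<close>.\<close>
  have "q * ((q - 1) * \<Sum>{d..<d + Q}) = n * ((q - 1) * q ^ k)"
    using sum_hamming_weight_full_length[OF C x] MWS_code_sum_hamming_weight[OF mws]
    by (simp add: assms(1) S card_C n_def)
  then have "q * \<Sum>{d..<d + Q} = n * q ^ k"
    using q by (simp add: mult.left_commute)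
  then have "real q * (2 * real (\<Sum>{d..<d + Q})) = 2 * real n * real (q ^ k)"
    by (metis (no_types) mult.assoc mult.left_commute of_nat_mult)
  then have "real q * (real Q * (2 * real d + real Q - 1)) = 2 * real n * (q' * real Q + 1)"
    by (simp only: real_sum_consecutive Q)
  then have "(real Q - 1) * (2 * real n - real q * real Q) = 0"
    unfolding n q'_def by (simp add: algebra_simps)
  then have "2 * real n = real q * real Q"
    using Q1 by simp
  then show ?thesis
    using n by (simp add: n_def[symmetric] d_def[symmetric] Q_def[symmetric] field_simps)
qed

end
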